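(* Let $N_x, N_T, m$ be positive integers, let $\omega_C > 0$, and let $\Phi, \Phi_\triangle \in \mathbb{R}^{N_x\times N_x}$. Assume that $\Phi$ and $\Phi_\triangle$ have the same set of eigenvectors $\{v_\gamma\}_{\gamma=1}^{N_x}$ (forming a basis of $\mathbb{C}^{N_x}$), with eigenvalues $\{\lambda_\gamma\}$ and $\{\mu_\gamma\}$ respectively, i.e. $\Phi v_\gamma = \lambda_\gamma v_\gamma$ and $\Phi_\triangle v_\gamma = \mu_\gamma v_\gamma$, where $|\lambda_\gamma|, |\mu_\gamma| < 1$ for all $\gamma \in \{1,\dots,N_x\}$. Let $\widetilde{U}$ denote the block-diagonal matrix with $N_T$ diagonal blocks, each given by the eigenvector matrix $[v_1,\dots,v_{N_x}]$ of $\Phi$ and $\Phi_\triangle$. Let $E_{\triangle,\omega_C}^{FCF} = (I - \mathbf{B}_\triangle^{-1}\mathbf{A}_\triangle)(I - \omega_C \mathbf{A}_\triangle)$ be the two-level MGRIT error propagator at C-points with weighted FCF-relaxation. Then $$\|E_{\triangle,\omega_C}^{FCF}\|_{(\widetilde{U}\widetilde{U}^* )^{-1}} \leq \max_{\gamma}\ \max_{x\in[0,2\pi]} \frac{|\lambda_\gamma^m - \mu_\gamma|}{|1 - e^{ix}\mu_\gamma|}\,\bigl|1-\omega_C + e^{ix}\omega_C\lambda_\gamma^m\bigr|.$$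
   Context: Multigrid reduction in time (MGRIT) is applied to the time-stepping recurrence $\mathbf{u}_j = \Phi\mathbf{u}_{j-1} + \mathbf{g}_j$ in $N_x$ spatial unknowns, with temporal coarsening factor $m$ and $N_T$ coarse time points (C-points). $\Phi$ is the fine-grid one-step integration operator, and $\Phi_\triangle$ is the coarse-grid one-step operator that approximates $\Phi^m$. The number $\omega_C>0$ is the relaxation weight used in C-relaxation. The matrix $\mathbf{A}_\triangle$ is the $N_T \times N_T$ block matrix (with blocks of size $N_x\times N_x$) having identity blocks $I$ on the block diagonal, blocks $-\Phi^m$ on the first block subdiagonal, and zero blocks elsewhere. The matrix $\mathbf{B}_\triangle$ has the same structure with $\Phi^m$ replaced by $\Phi_\triangle$, i.e. identity blocks on the block diagonal, $-\Phi_\triangle$ on the first block subdiagonal, and zero blocks elsewhere. For the Hermitian positive definite matrix $M = (\widetilde{U}\widetilde{U}^* )^{-1}$, the vector norm is $\|\mathbf{x}\|_M = (\mathbf{x}^* M \mathbf{x})^{1/2}$ for $\mathbf{x}\in\mathbb{C}^{N_xN_T}$, and for a matrix $E$, $\|E\|_M = \sup_{\mathbf{x}\neq 0} \|E\mathbf{x}\|_M/\|\mathbf{x}\|_M$ is the induced operator norm. *)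

theory Defs
  imports
    "HOL-Analysis.Analysis"
    "Jordan_Normal_Form.VS_Connect"
    "Jordan_Normal_Form.Char_Poly"
    "Jordan_Normal_Form.Gauss_Jordan_Elimination"
    "Jordan_Normal_Form.Schur_Decomposition"
begin

(* Only meaningful for invertible matrices. *)
definition inv_mat :: "'a::field mat \<Rightarrow> 'a mat" where
  "inv_mat A = the (mat_inverse A)"

(* F p q is the block in block row p and block column q, both counted from 0;
   all blocks are n x n.  The ordering agrees with that of diag_block_mat. *)
definition uniform_block_mat :: "nat \<Rightarrow> nat \<Rightarrow> (nat \<Rightarrow> nat \<Rightarrow> 'a mat) \<Rightarrow> 'a mat" where
  "uniform_block_mat N n F =
     mat (N * n) (N * n) (\<lambda>(i, j). F (i div n) (j div n) $$ (i mod n, j mod n))"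

definition time_stepping_mat :: "nat \<Rightarrow> nat \<Rightarrow> 'a::ring_1 mat \<Rightarrow> 'a mat" where
  "time_stepping_mat N n P =
     uniform_block_mat N n
       (\<lambda>p q. if p = q then 1\<^sub>m n else if p = Suc q then - P else 0\<^sub>m n n)"

(* The arguments are N_T, N_x, m, the relaxation weight, and the fine-grid and
   coarse-grid one-step operators. *)
definition mgrit_FCF_error ::
    "nat \<Rightarrow> nat \<Rightarrow> nat \<Rightarrow> 'a::field \<Rightarrow> 'a mat \<Rightarrow> 'a mat \<Rightarrow> 'a mat" where
  "mgrit_FCF_error N n m \<omega> \<Phi> \<Phi>c =
     (let A = time_stepping_mat N n (\<Phi> ^\<^sub>m m);
          B = time_stepping_mat N n \<Phi>c
      in (1\<^sub>m (N * n) - inv_mat B * A) * (1\<^sub>m (N * n) - \<omega> \<cdot>\<^sub>m A))"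

(* (M *\<^sub>v x) \<bullet>c x is x* M x, since \<bullet>c conjugates its second argument;
   it is real and nonnegative for Hermitian positive definite M. *)
definition weighted_norm :: "complex mat \<Rightarrow> complex vec \<Rightarrow> real" where
  "weighted_norm M x = sqrt (Re ((M *\<^sub>v x) \<bullet>c x))"

definition weighted_op_norm :: "complex mat \<Rightarrow> complex mat \<Rightarrow> real" where
  "weighted_op_norm M E =
     (SUP x \<in> carrier_vec (dim_row M) - {0\<^sub>v (dim_row M)}.
        weighted_norm M (E *\<^sub>v x) / weighted_norm M x)"

end

theory Submission
  imports Defs "Jordan_Normal_Form.DL_Rank"
begin

text \<open>
  Let \<open>V\<close> be the eigenvector matrix, so that \<open>U\<close> is block diagonal with blocks \<open>V\<close>. Since
  \<open>(U U\<^sup>*)\<^sup>-\<^sup>1 = U\<^sup>-\<^sup>* U\<^sup>-\<^sup>1\<close>, the weighted norm of \<open>x\<close> is the Euclidean norm of \<open>U\<^sup>-\<^sup>1 x\<close>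
  (\<open>weighted_norm_inv_gram\<close>). In the coordinates \<open>U\<^sup>-\<^sup>1 x\<close> the error propagator decouples into one
  scalar two-level iteration in time per eigenvector (\<open>mgrit_FCF_error_eigenbasis\<close>), and it remains
  to bound each of these in the Euclidean norm.

  Write \<open>a = \<lambda>\<^sup>m\<close>. The scalar iteration is a truncated lower triangular Toeplitz operator with
  symbol \<open>(a - \<mu>) z (1 - \<omega> + \<omega> a z) / (1 - \<mu> z)\<close>, so its norm is at most the maximum \<open>C\<close> of the
  modulus of the symbol on the unit circle. This is proved in the time domain, without Fourier
  analysis. Multiplying the input \<open>y\<close> by \<open>z / (1 - \<mu> z)\<close> gives a state \<open>t\<close>, in terms of which both
  \<open>y\<^sub>p = t\<^sub>p\<^sub>+\<^sub>1 - \<mu> t\<^sub>p\<close> and the output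
  \<open>r\<^sub>p\<^sub>+\<^sub>1 = (a - \<mu>) ((1 - \<omega>) t\<^sub>p\<^sub>+\<^sub>1 + \<omega> a t\<^sub>p)\<close> are local. The bound on the circle implies
  that, for some real \<open>K\<close>,
  \<open>\<bar>r\<^sub>p\<^sub>+\<^sub>1\<bar>\<^sup>2 + K (\<bar>t\<^sub>p\<^sub>+\<^sub>1\<bar>\<^sup>2 - \<bar>t\<^sub>p\<bar>\<^sup>2) \<le> C\<^sup>2 \<bar>y\<^sub>p\<bar>\<^sup>2\<close> (\<open>dissipation_inequality\<close>).
  Summation telescopes the middle term. The sign of \<open>K\<close> does not matter: with \<open>y\<close>
  extended by zero, \<open>t\<close> decays like \<open>\<mu>\<^sup>k\<close>, and the boundary term vanishes in the limit
  (\<open>fcf_scalar_bound\<close>).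
\<close>

(* Both $ and the dot product are also notation for Euclidean vectors; dropping that reading keeps
   terms over matrices unambiguous. *)
unbundle no vec_syntax
no_notation inner (infix "\<bullet>" 70)

section \<open>The scalar iteration\<close>

text \<open>The C-point error propagator for a single mode: \<open>w\<close> is the relaxation weight, \<open>a\<close> and \<open>\<mu>\<close> are
  the eigenvalues of the exact and of the approximate coarse step, \<open>y\<close> is the error before the
  iteration. If \<open>z\<^sub>p = (1 - w) y\<^sub>p + w a y\<^sub>p\<^sub>-\<^sub>1\<close> is the relaxed error (with \<open>y\<^sub>-\<^sub>1 = 0\<close>), then the
  new error solves \<open>r\<^sub>p\<^sub>+\<^sub>1 = \<mu> r\<^sub>p + (a - \<mu>) z\<^sub>p\<close> with \<open>r\<^sub>0 = 0\<close>.\<close>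

primrec fcf_scalar :: "complex \<Rightarrow> complex \<Rightarrow> complex \<Rightarrow> (nat \<Rightarrow> complex) \<Rightarrow> nat \<Rightarrow> complex" where
  "fcf_scalar w a \<mu> y 0 = 0"
| "fcf_scalar w a \<mu> y (Suc p) = \<mu> * fcf_scalar w a \<mu> y p
     + (a - \<mu>) * ((1 - w) * y p + w * a * (if p = 0 then 0 else y (p - 1)))"

lemma cmod_add_square:
  "(cmod (x + y))\<^sup>2 = (cmod x)\<^sup>2 + (cmod y)\<^sup>2 + 2 * Re (y * cnj x)"
  by (simp only: cmod_power2) (simp add: power2_eq_square algebra_simps)

text \<open>A Hermitian form in two variables with equal diagonal entries is nonnegative as soon as it is
  nonnegative on vectors whose entries have modulus one.\<close>

lemma quadratic_form_nonneg:
  fixes h :: real and \<beta> s t :: complex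
  assumes "\<And>z. cmod z = 1 \<Longrightarrow> 0 \<le> h + Re (\<beta> * z)"
  shows "0 \<le> h * ((cmod s)\<^sup>2 + (cmod t)\<^sup>2) + 2 * Re (\<beta> * (t * cnj s))"
proof -
  define \<rho> where "\<rho> = cmod s * cmod t"
  obtain z where z: "cmod z = 1" "t * cnj s = of_real \<rho> * z"
  proof (cases "\<rho> = 0")
    case True
    then show ?thesis by (intro that[of 1]) (auto simp: \<rho>_def)
  next
    case False
    have "cmod (t * cnj s) = \<rho>" by (simp add: \<rho>_def norm_mult)
    moreover have "\<rho> \<ge> 0" by (simp add: \<rho>_def)
    ultimately show ?thesis using False
      by (intro that[of "(t * cnj s) / of_real \<rho>"]) (auto simp: norm_divide)
  qed
  \<comment> \<open>The real parts at the antipodal points \<open>1\<close> and \<open>-1\<close> cancel.\<close>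
  have "h \<ge> 0" using assms[of 1] assms[of "-1"] by simp
  have "\<rho> \<ge> 0" by (simp add: \<rho>_def)
  have re: "Re (\<beta> * (t * cnj s)) = \<rho> * Re (\<beta> * z)"
    unfolding z(2) by (simp add: algebra_simps)
  have "0 \<le> h * (cmod s - cmod t)\<^sup>2" using \<open>h \<ge> 0\<close> by simp
  also have "\<dots> = h * ((cmod s)\<^sup>2 + (cmod t)\<^sup>2) - 2 * (\<rho> * h)"
    by (simp add: \<rho>_def power2_eq_square algebra_simps)
  also have "\<dots> \<le> h * ((cmod s)\<^sup>2 + (cmod t)\<^sup>2) + 2 * (\<rho> * Re (\<beta> * z))"
    using mult_left_mono[OF assms[OF z(1)] \<open>\<rho> \<ge> 0\<close>] by (simp add: algebra_simps)
  finally show ?thesis using re by simp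
qed

text \<open>The difference of the two sides of the bound, squared and homogenised, is a Hermitian form in
  \<open>(s, t)\<close> with diagonal entries \<open>\<alpha>1\<close> and \<open>\<alpha>2\<close>. On \<open>\<bar>s\<bar> = \<bar>t\<bar>\<close> only their sum matters, so
  subtracting \<open>K (\<bar>s\<bar>\<^sup>2 - \<bar>t\<bar>\<^sup>2)\<close> with \<open>K = (\<alpha>1 - \<alpha>2) / 2\<close> equalises the diagonal without affecting
  the hypothesis, and the preceding lemma applies.\<close>

lemma dissipation_inequality:
  fixes c e b \<mu> :: complex and C :: real
  assumes bound: "\<And>z. cmod z = 1 \<Longrightarrow> cmod b * cmod (c + z * e) \<le> C * cmod (1 - z * \<mu>)"
  obtains K :: real where "\<And>s t. (cmod (b * (c * s + e * t)))\<^sup>2 + K * ((cmod s)\<^sup>2 - (cmod t)\<^sup>2)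
      \<le> C\<^sup>2 * (cmod (s - \<mu> * t))\<^sup>2"
proof -
  define B where "B = (cmod b)\<^sup>2"
  define \<alpha>1 where "\<alpha>1 = C\<^sup>2 - B * (cmod c)\<^sup>2"
  define \<alpha>2 where "\<alpha>2 = C\<^sup>2 * (cmod \<mu>)\<^sup>2 - B * (cmod e)\<^sup>2"
  define \<beta> where "\<beta> = - of_real (C\<^sup>2) * \<mu> - of_real B * e * cnj c"
  have expand: "C\<^sup>2 * (cmod (s - \<mu> * t))\<^sup>2 - (cmod (b * (c * s + e * t)))\<^sup>2
      = \<alpha>1 * (cmod s)\<^sup>2 + \<alpha>2 * (cmod t)\<^sup>2 + 2 * Re (\<beta> * (t * cnj s))" for s t
  proof -
    have 1: "(cmod (s - \<mu> * t))\<^sup>2 = (cmod s)\<^sup>2 + (cmod \<mu>)\<^sup>2 * (cmod t)\<^sup>2 - 2 * Re (\<mu> * t * cnj s)"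
      using cmod_add_square[of s "- (\<mu> * t)"] by (simp add: norm_mult power_mult_distrib)
    have 2: "(cmod (c * s + e * t))\<^sup>2 = (cmod c)\<^sup>2 * (cmod s)\<^sup>2 + (cmod e)\<^sup>2 * (cmod t)\<^sup>2
        + 2 * Re (e * cnj c * (t * cnj s))"
      using cmod_add_square[of "c * s" "e * t"] by (simp add: norm_mult power_mult_distrib ac_simps)
    have 3: "Re (\<beta> * (t * cnj s)) = - C\<^sup>2 * Re (\<mu> * t * cnj s) - B * Re (e * cnj c * (t * cnj s))"
    proof -
      have "\<beta> * (t * cnj s) = (- C\<^sup>2) *\<^sub>R (\<mu> * t * cnj s) + (- B) *\<^sub>R (e * cnj c * (t * cnj s))"
        by (simp add: \<beta>_def scaleR_conv_of_real algebra_simps)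
      then show ?thesis by (simp only: plus_complex.sel scaleR_complex.sel)
    qed
    show ?thesis
      unfolding norm_mult power_mult_distrib 1 2 3 \<alpha>1_def \<alpha>2_def B_def
      by (simp add: algebra_simps)
  qed
  have nonneg: "0 \<le> (\<alpha>1 + \<alpha>2) / 2 + Re (\<beta> * z)" if z: "cmod z = 1" for z
  proof -
    have "(cmod (b * (c * 1 + e * z)))\<^sup>2 \<le> (C * cmod (1 - \<mu> * z))\<^sup>2"
      using bound[OF z] by (intro power_mono) (simp_all add: norm_mult ac_simps)
    then have "0 \<le> \<alpha>1 + \<alpha>2 + 2 * Re (\<beta> * z)"
      using expand[of 1 z] z by (simp add: power_mult_distrib)
    then have "0 \<le> (\<alpha>1 + \<alpha>2 + 2 * Re (\<beta> * z)) / 2" by (rule divide_nonneg_nonneg) simp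
    then show ?thesis by (simp only: add_divide_distrib)
  qed
  show ?thesis
  proof (rule that)
    fix s t
    define S T R where "S = (cmod s)\<^sup>2" and "T = (cmod t)\<^sup>2" and "R = Re (\<beta> * (t * cnj s))"
    have "0 \<le> (\<alpha>1 + \<alpha>2) / 2 * (S + T) + 2 * R"
      using quadratic_form_nonneg[OF nonneg, of s t] unfolding S_def T_def R_def .
    moreover have "\<alpha>1 * S + \<alpha>2 * T = (\<alpha>1 - \<alpha>2) / 2 * (S - T) + (\<alpha>1 + \<alpha>2) / 2 * (S + T)"
      by (simp add: field_simps)
    moreover have "C\<^sup>2 * (cmod (s - \<mu> * t))\<^sup>2 - (cmod (b * (c * s + e * t)))\<^sup>2 = \<alpha>1 * S + \<alpha>2 * T + 2 * R"
      unfolding S_def T_def R_def by (rule expand)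
    ultimately have "(cmod (b * (c * s + e * t)))\<^sup>2 + (\<alpha>1 - \<alpha>2) / 2 * (S - T) \<le> C\<^sup>2 * (cmod (s - \<mu> * t))\<^sup>2"
      by linarith
    then show "(cmod (b * (c * s + e * t)))\<^sup>2 + (\<alpha>1 - \<alpha>2) / 2 * ((cmod s)\<^sup>2 - (cmod t)\<^sup>2)
      \<le> C\<^sup>2 * (cmod (s - \<mu> * t))\<^sup>2"
      unfolding S_def T_def .
  qed
qed

text \<open>The symbol bound is stated without the factor \<open>z\<close> of modulus one and without division.\<close>

lemma fcf_scalar_bound:
  fixes w a \<mu> :: complex and C :: real
  assumes mu: "cmod \<mu> < 1"
    and bound: "\<And>z. cmod z = 1 \<Longrightarrow>
      cmod (a - \<mu>) * cmod (1 - w + z * (w * a)) \<le> C * cmod (1 - z * \<mu>)"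
    and y: "\<And>p. p \<ge> N \<Longrightarrow> y p = 0"
  shows "(\<Sum>p<N. (cmod (fcf_scalar w a \<mu> y p))\<^sup>2) \<le> C\<^sup>2 * (\<Sum>p<N. (cmod (y p))\<^sup>2)"
proof -
  define r where "r = fcf_scalar w a \<mu> y"
  define t where "t = rec_nat 0 (\<lambda>p s. \<mu> * s + y p)"
  have t0: "t 0 = 0" and tS: "t (Suc p) = \<mu> * t p + y p" for p by (simp_all add: t_def)
  have r0: "r 0 = 0" by (simp add: r_def)
  have rS: "r (Suc p) = (a - \<mu>) * ((1 - w) * t (Suc p) + w * a * t p)" for p
  proof (induction p)
    case 0 show ?case by (simp add: r_def t0 tS)
  next
    case (Suc p)
    have "r (Suc (Suc p)) = \<mu> * r (Suc p) + (a - \<mu>) * ((1 - w) * y (Suc p) + w * a * y p)"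
      by (simp add: r_def)
    then show ?case by (simp add: Suc.IH tS algebra_simps)
  qed
  obtain K where K: "\<And>s t. (cmod ((a - \<mu>) * ((1 - w) * s + w * a * t)))\<^sup>2
      + K * ((cmod s)\<^sup>2 - (cmod t)\<^sup>2) \<le> C\<^sup>2 * (cmod (s - \<mu> * t))\<^sup>2"
    using dissipation_inequality[OF bound] by blast
  have sum_le: "(\<Sum>p<L. (cmod (r (Suc p)))\<^sup>2) + K * (cmod (t L))\<^sup>2 \<le> C\<^sup>2 * (\<Sum>p<L. (cmod (y p))\<^sup>2)" for L
  proof (induction L)
    case 0 show ?case by (simp add: t0)
  next
    case (Suc L)
    have "(cmod (r (Suc L)))\<^sup>2 + K * ((cmod (t (Suc L)))\<^sup>2 - (cmod (t L))\<^sup>2) \<le> C\<^sup>2 * (cmod (y L))\<^sup>2"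
      using K[of "t (Suc L)" "t L"] unfolding rS[symmetric] by (simp add: tS)
    then show ?case using Suc.IH by (simp add: algebra_simps)
  qed
  have tN: "t (N + k) = \<mu> ^ k * t N" for k
    by (induction k) (simp_all add: tS y)
  \<comment> \<open>Running the iteration for \<open>k\<close> further steps with zero input makes the boundary term small.\<close>
  have "(\<Sum>p<N. (cmod (r p))\<^sup>2) + K * (cmod (\<mu> ^ k * t N))\<^sup>2 \<le> C\<^sup>2 * (\<Sum>p<N. (cmod (y p))\<^sup>2)" for k
  proof -
    have "(\<Sum>p<N. (cmod (r p))\<^sup>2) \<le> (\<Sum>p<Suc (N + k). (cmod (r p))\<^sup>2)"
      by (intro sum_mono2) auto
    also have "\<dots> = (\<Sum>p<N + k. (cmod (r (Suc p)))\<^sup>2)"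
      by (subst sum.lessThan_Suc_shift) (simp add: r0)
    finally have 1: "(\<Sum>p<N. (cmod (r p))\<^sup>2) \<le> (\<Sum>p<N + k. (cmod (r (Suc p)))\<^sup>2)" .
    have 2: "(\<Sum>p<N + k. (cmod (y p))\<^sup>2) = (\<Sum>p<N. (cmod (y p))\<^sup>2)"
      by (intro sum.mono_neutral_right) (auto simp: y)
    show ?thesis using 1 sum_le[of "N + k"] unfolding tN 2 by linarith
  qed
  moreover have "(\<lambda>k. (\<Sum>p<N. (cmod (r p))\<^sup>2) + K * (cmod (\<mu> ^ k * t N))\<^sup>2)
      \<longlonglongrightarrow> (\<Sum>p<N. (cmod (r p))\<^sup>2) + K * (cmod (0 * t N))\<^sup>2"
    by (intro tendsto_intros LIMSEQ_power_zero mu)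
  ultimately have "(\<Sum>p<N. (cmod (r p))\<^sup>2) + K * (cmod (0 * t N))\<^sup>2 \<le> C\<^sup>2 * (\<Sum>p<N. (cmod (y p))\<^sup>2)"
    by (intro LIMSEQ_le_const2) auto
  then show ?thesis by (simp add: r_def)
qed

section \<open>Maximum over the circle\<close>

text \<open>\<open>Greatest\<close> is meaningful only if a greatest element exists; here it exists by compactness.\<close>

lemma Greatest_image_ge:
  fixes f :: "real \<Rightarrow> real"
  assumes "continuous_on S f" "compact S" "x \<in> S"
  shows "f x \<le> (GREATEST r. \<exists>x\<in>S. r = f x)"
proof -
  obtain x0 where x0: "x0 \<in> S" "\<And>y. y \<in> S \<Longrightarrow> f y \<le> f x0"
    using continuous_attains_sup[OF assms(2) _ assms(1)] assms(3) by blast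
  have "(GREATEST r. \<exists>x\<in>S. r = f x) = f x0"
    by (rule Greatest_equality) (use x0 in auto)
  then show ?thesis using x0(2) assms(3) by simp
qed

lemma symbol_le_Greatest:
  fixes a \<mu> w z :: complex
  assumes mu: "cmod \<mu> < 1" and z: "cmod z = 1"
  shows "cmod (a - \<mu>) / cmod (1 - z * \<mu>) * cmod (1 - w + z * w * a)
    \<le> (GREATEST r. \<exists>x\<in>{0..2 * pi}.
          r = cmod (a - \<mu>) / cmod (1 - exp (\<i> * of_real x) * \<mu>)
              * cmod (1 - w + exp (\<i> * of_real x) * w * a))"
proof -
  \<comment> \<open>The denominators do not vanish, so that the symbol is continuous.\<close>
  have ne: "exp (\<i> * complex_of_real x) * \<mu> \<noteq> 1" for x
    using mu by (metis mult_1 norm_exp_i_times norm_mult norm_one order_less_irrefl)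
  let ?f = "\<lambda>x. cmod (a - \<mu>) / cmod (1 - exp (\<i> * complex_of_real x) * \<mu>)
              * cmod (1 - w + exp (\<i> * of_real x) * w * a)"
  have "continuous_on {0..2 * pi} ?f"
    by (intro continuous_intros) (auto simp: ne)
  moreover have "Arg2pi z \<in> {0..2 * pi}"
    using Arg2pi[of z] by simp
  ultimately have "?f (Arg2pi z) \<le> (GREATEST r. \<exists>x\<in>{0..2 * pi}. r = ?f x)"
    by (rule Greatest_image_ge[OF _ compact_Icc])
  moreover have "exp (\<i> * of_real (Arg2pi z)) = z"
    using Arg2pi_eq[of z] z by simp
  ultimately show ?thesis by simp
qed

section \<open>Block matrices\<close>

lemma block_index_less:
  fixes p i n N :: nat
  assumes "p < N" "i < n"
  shows "p * n + i < N * n"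
proof -
  have "p * n + i < Suc p * n" using assms by simp
  also have "\<dots> \<le> N * n" using assms by (intro mult_right_mono) auto
  finally show ?thesis .
qed

lemma block_indexE:
  fixes j n N :: nat
  assumes "j < N * n"
  obtains p i where "p < N" "i < n" "j = p * n + i"
proof (rule that)
  show "j div n < N" using assms by (simp add: less_mult_imp_div_less)
  have "n > 0" using assms by (cases n) auto
  then show "j mod n < n" by simp
qed simp

lemma sum_blocks:
  fixes f :: "nat \<Rightarrow> 'a::comm_monoid_add"
  shows "(\<Sum>j<N * n. f j) = (\<Sum>p<N. \<Sum>i<n. f (p * n + i))"
proof -
  have "(\<Sum>j<N * n. f j) = (\<Sum>p<N. \<Sum>j\<in>{p * n..<p * n + n}. f j)"
    by (rule sum.nat_group[symmetric])
  also have "\<dots> = (\<Sum>p<N. \<Sum>i<n. f (p * n + i))"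
  proof (rule sum.cong[OF refl])
    fix p
    show "(\<Sum>j\<in>{p * n..<p * n + n}. f j) = (\<Sum>i<n. f (p * n + i))"
      using sum.shift_bounds_nat_ivl[of f 0 "p * n" n]
      by (simp add: atLeast0LessThan ac_simps)
  qed
  finally show ?thesis .
qed

lemma uniform_block_mat_carrier [simp]:
  "uniform_block_mat N n F \<in> carrier_mat (N * n) (N * n)"
  by (simp add: uniform_block_mat_def)

lemma time_stepping_mat_carrier [simp]:
  "time_stepping_mat N n P \<in> carrier_mat (N * n) (N * n)"
  by (simp add: time_stepping_mat_def)

lemma mult_mat_vec_index_sum:
  assumes "A \<in> carrier_mat nr nc" "x \<in> carrier_vec nc" "i < nr"
  shows "(A *\<^sub>v x) $ i = (\<Sum>j<nc. A $$ (i, j) * x $ j)"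
  using assms by (simp add: scalar_prod_def atLeast0LessThan)

lemma uniform_block_mat_index:
  assumes "p < N" "i < n" "q < N" "k < n"
  shows "uniform_block_mat N n F $$ (p * n + i, q * n + k) = F p q $$ (i, k)"
  using assms by (simp add: uniform_block_mat_def block_index_less)

lemma uniform_block_mat_mult_vec_index:
  assumes "x \<in> carrier_vec (N * n)" "p < N" "i < n"
  shows "(uniform_block_mat N n F *\<^sub>v x) $ (p * n + i)
    = (\<Sum>q<N. \<Sum>k<n. F p q $$ (i, k) * x $ (q * n + k))"
  unfolding mult_mat_vec_index_sum[OF uniform_block_mat_carrier assms(1) block_index_less[OF assms(2,3)]]
    sum_blocks
  using assms by (intro sum.cong refl) (simp add: uniform_block_mat_index)

lemma diag_block_mat_replicate_carrier:
  assumes "V \<in> carrier_mat n n"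
  shows "diag_block_mat (replicate N V) \<in> carrier_mat (N * n) (N * n)"
  using assms by (auto intro!: carrier_matI simp: dim_diag_block_mat sum_list_replicate)

lemma diag_block_mat_replicate:
  assumes V: "V \<in> carrier_mat n n"
  shows "diag_block_mat (replicate N V)
    = uniform_block_mat N n (\<lambda>p q. if p = q then V else 0\<^sub>m n n)"
proof (induction N)
  case 0
  show ?case by (rule eq_matI) (simp_all add: uniform_block_mat_def)
next
  case (Suc N)
  let ?F = "\<lambda>p q. if p = (q::nat) then V else 0\<^sub>m n n"
  have dims: "dim_row V = n" "dim_col V = n" using V by auto
  have eq: "diag_block_mat (replicate (Suc N) V) = four_block_mat V (0\<^sub>m n (N * n)) (0\<^sub>m (N * n) n)
      (uniform_block_mat N n ?F)"
    using Suc.IH dims by (simp add: Let_def uniform_block_mat_def)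
  show ?case unfolding eq
  proof (rule eq_matI)
    fix i j assume "i < dim_row (uniform_block_mat (Suc N) n ?F)"
      "j < dim_col (uniform_block_mat (Suc N) n ?F)"
    then have ij: "i < Suc N * n" "j < Suc N * n" by (simp_all add: uniform_block_mat_def)
    have "n > 0" using ij by (cases n) auto
    have shift: "\<exists>k'. k = k' + n \<and> k' < N * n" if "\<not> k < n" "k < Suc N * n" for k
      using that by (intro exI[of _ "k - n"]) auto
    note [simp] = \<open>n > 0\<close> dims uniform_block_mat_def
    show "four_block_mat V (0\<^sub>m n (N * n)) (0\<^sub>m (N * n) n) (uniform_block_mat N n ?F) $$ (i, j)
        = uniform_block_mat (Suc N) n ?F $$ (i, j)"
    proof (cases "i < n"; cases "j < n")
      assume "i < n" "j < n"
      then show ?thesis using ij by simp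
    next
      assume "i < n" "\<not> j < n"
      moreover from this obtain j' where "j = j' + n" "j' < N * n" using shift ij by blast
      ultimately show ?thesis by simp
    next
      assume "\<not> i < n" "j < n"
      moreover from this obtain i' where "i = i' + n" "i' < N * n" using shift ij by blast
      ultimately show ?thesis by simp
    next
      assume "\<not> i < n" "\<not> j < n"
      moreover from this obtain i' j' where "i = i' + n" "i' < N * n" "j = j' + n" "j' < N * n"
        using shift ij by metis
      ultimately show ?thesis by simp
    qed
  qed (use dims in \<open>auto simp: uniform_block_mat_def\<close>)
qed

lemma diag_block_mat_replicate_mult_vec_index:
  fixes V :: "'a::comm_ring_1 mat"
  assumes V: "V \<in> carrier_mat n n" and "x \<in> carrier_vec (N * n)" "p < N" "i < n"
  shows "(diag_block_mat (replicate N V) *\<^sub>v x) $ (p * n + i) = (\<Sum>k<n. V $$ (i, k) * x $ (p * n + k))"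
proof -
  have "(diag_block_mat (replicate N V) *\<^sub>v x) $ (p * n + i)
      = (\<Sum>q<N. if p = q then (\<Sum>k<n. V $$ (i, k) * x $ (p * n + k)) else 0)"
    unfolding diag_block_mat_replicate[OF V] uniform_block_mat_mult_vec_index[OF assms(2-4)]
    using assms by (intro sum.cong refl) (auto intro!: sum.neutral)
  then show ?thesis using assms by simp
qed

lemma time_stepping_mat_mult_vec_index:
  fixes P :: "'a::comm_ring_1 mat"
  assumes P: "P \<in> carrier_mat n n" and x: "x \<in> carrier_vec (N * n)" and "p < N" "i < n"
  shows "(time_stepping_mat N n P *\<^sub>v x) $ (p * n + i)
    = x $ (p * n + i) - (if p = 0 then 0 else \<Sum>k<n. P $$ (i, k) * x $ ((p - 1) * n + k))"
proof -
  let ?F = "\<lambda>p q. if p = q then 1\<^sub>m n else if p = Suc q then - P else 0\<^sub>m n n"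
  have "(time_stepping_mat N n P *\<^sub>v x) $ (p * n + i)
      = (\<Sum>q<N. \<Sum>k<n. ?F p q $$ (i, k) * x $ (q * n + k))"
    unfolding time_stepping_mat_def by (rule uniform_block_mat_mult_vec_index[OF x assms(3,4)])
  also have "\<dots> = (\<Sum>q<N. (if q = p then x $ (p * n + i) else 0)
      - (if Suc q = p then \<Sum>k<n. P $$ (i, k) * x $ (q * n + k) else 0))"
  proof (intro sum.cong refl)
    fix q
    have "(\<Sum>k<n. 1\<^sub>m n $$ (i, k) * x $ (p * n + k)) = (\<Sum>k<n. if k = i then x $ (p * n + i) else 0)"
      using assms by (intro sum.cong refl) auto
    then have 1: "(\<Sum>k<n. 1\<^sub>m n $$ (i, k) * x $ (p * n + k)) = x $ (p * n + i)"
      using assms by simp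
    have 2: "(\<Sum>k<n. (- P) $$ (i, k) * x $ (q * n + k)) = - (\<Sum>k<n. P $$ (i, k) * x $ (q * n + k))"
      unfolding sum_negf[symmetric] using assms by (intro sum.cong refl) auto
    show "(\<Sum>k<n. ?F p q $$ (i, k) * x $ (q * n + k)) = (if q = p then x $ (p * n + i) else 0)
      - (if Suc q = p then \<Sum>k<n. P $$ (i, k) * x $ (q * n + k) else 0)"
      using 1 2 assms by (auto intro!: sum.neutral)
  qed
  also have "\<dots> = x $ (p * n + i)
      - (\<Sum>q<N. if Suc q = p then \<Sum>k<n. P $$ (i, k) * x $ (q * n + k) else 0)"
    using assms by (simp add: sum_subtractf)
  also have "(\<Sum>q<N. if Suc q = p then \<Sum>k<n. P $$ (i, k) * x $ (q * n + k) else 0)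
      = (if p = 0 then 0 else \<Sum>k<n. P $$ (i, k) * x $ ((p - 1) * n + k))"
    using assms by (cases p) auto
  finally show ?thesis .
qed

text \<open>If the columns of \<open>V\<close> are eigenvectors of \<open>P\<close>, then in the basis of the columns of the block
  diagonal matrix the block subdiagonal \<open>-P\<close> turns into multiplication by \<open>-lam k\<close>. The entry of
  mode \<open>k\<close> at time \<open>p\<close> has the flat index \<open>j = p * n + k\<close>, so \<open>j mod n\<close> is the mode and
  \<open>j - n\<close> is the same mode one time step earlier.\<close>

lemma time_stepping_mat_eigenbasis:
  fixes P V :: "'a::comm_ring_1 mat"
  assumes P: "P \<in> carrier_mat n n" and V: "V \<in> carrier_mat n n" and y: "y \<in> carrier_vec (N * n)"
    and eig: "\<And>i k. i < n \<Longrightarrow> k < n \<Longrightarrow> (\<Sum>j<n. P $$ (i, j) * V $$ (j, k)) = lam k * V $$ (i, k)"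
  shows "time_stepping_mat N n P *\<^sub>v (diag_block_mat (replicate N V) *\<^sub>v y)
    = diag_block_mat (replicate N V) *\<^sub>v
        vec (N * n) (\<lambda>j. y $ j - (if j < n then 0 else lam (j mod n) * y $ (j - n)))"
    (is "?T *\<^sub>v (?U *\<^sub>v y) = ?U *\<^sub>v ?y'")
proof (rule eq_vecI)
  have U: "?U \<in> carrier_mat (N * n) (N * n)" by (rule diag_block_mat_replicate_carrier[OF V])
  have Uy: "?U *\<^sub>v y \<in> carrier_vec (N * n)" using U y by auto
  have y': "?y' \<in> carrier_vec (N * n)" by simp
  show "dim_vec (?T *\<^sub>v (?U *\<^sub>v y)) = dim_vec (?U *\<^sub>v ?y')"
    using U carrier_matD(1)[OF time_stepping_mat_carrier[of N n P]] by simp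
  fix j assume "j < dim_vec (?U *\<^sub>v ?y')"
  then have "j < N * n" using U by simp
  then obtain p i where j: "p < N" "i < n" "j = p * n + i" by (rule block_indexE)
  have y'_index: "?y' $ (p * n + k) = y $ (p * n + k) - (if p = 0 then 0 else lam k * y $ ((p - 1) * n + k))"
    if "k < n" for k
  proof (cases "p = 0")
    case True
    then show ?thesis using that block_index_less[OF j(1) that] by simp
  next
    case False
    then have shift: "p * n + k = (p - 1) * n + k + n" by (cases p) auto
    then have "\<not> p * n + k < n" "p * n + k - n = (p - 1) * n + k" by simp_all
    moreover have "(p * n + k) mod n = k" using that by simp
    ultimately show ?thesis using False block_index_less[OF j(1) that] by simp
  qed
  have mid: "(\<Sum>k<n. P $$ (i, k) * (?U *\<^sub>v y) $ (q * n + k))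
      = (\<Sum>k<n. V $$ (i, k) * (lam k * y $ (q * n + k)))" if "q < N" for q
  proof -
    have "(\<Sum>k<n. P $$ (i, k) * (?U *\<^sub>v y) $ (q * n + k))
        = (\<Sum>k<n. \<Sum>l<n. P $$ (i, k) * (V $$ (k, l) * y $ (q * n + l)))"
      using that by (intro sum.cong refl)
        (simp add: diag_block_mat_replicate_mult_vec_index[OF V y] sum_distrib_left)
    also have "\<dots> = (\<Sum>l<n. (\<Sum>k<n. P $$ (i, k) * V $$ (k, l)) * y $ (q * n + l))"
      by (subst sum.swap) (simp add: sum_distrib_right mult.assoc)
    also have "\<dots> = (\<Sum>k<n. V $$ (i, k) * (lam k * y $ (q * n + k)))"
      using j by (intro sum.cong refl) (simp add: eig ac_simps)
    finally show ?thesis .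
  qed
  have "(\<Sum>k<n. V $$ (i, k) * ?y' $ (p * n + k)) = (\<Sum>k<n. V $$ (i, k) *
      (y $ (p * n + k) - (if p = 0 then 0 else lam k * y $ ((p - 1) * n + k))))"
    by (intro sum.cong refl) (simp only: y'_index lessThan_iff)
  also have "\<dots> = (\<Sum>k<n. V $$ (i, k) * y $ (p * n + k))
      - (if p = 0 then 0 else \<Sum>k<n. V $$ (i, k) * (lam k * y $ ((p - 1) * n + k)))"
    by (simp add: right_diff_distrib sum_subtractf)
  finally have rhs: "(\<Sum>k<n. V $$ (i, k) * ?y' $ (p * n + k)) = \<dots>" .
  show "(?T *\<^sub>v (?U *\<^sub>v y)) $ j = (?U *\<^sub>v ?y') $ j"
    unfolding j(3) time_stepping_mat_mult_vec_index[OF P Uy j(1,2)]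
      diag_block_mat_replicate_mult_vec_index[OF V y' j(1,2)]
      diag_block_mat_replicate_mult_vec_index[OF V y j(1,2)]
      rhs
    using j mid[of "p - 1"] by (simp del: index_mult_mat_vec)
qed

lemma det_time_stepping_mat:
  fixes P :: "'a::field mat"
  shows "det (time_stepping_mat N n P) = 1"
proof -
  let ?T = "time_stepping_mat N n P"
  have entry: "?T $$ (i, j) = (if i div n = j div n then 1\<^sub>m n $$ (i mod n, j mod n)
      else if i div n = Suc (j div n) then (- P) $$ (i mod n, j mod n) else 0)"
    if "i < N * n" "j < N * n" for i j
  proof -
    have "n > 0" using that by (cases n) auto
    then show ?thesis using that by (simp add: time_stepping_mat_def uniform_block_mat_def)
  qed
  have "?T $$ (i, j) = 0" if "i < j" "j < N * n" for i j
  proof -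
    have "n > 0" using that by (cases n) auto
    have "i div n \<le> j div n" using that by (simp add: div_le_mono)
    moreover have "i mod n \<noteq> j mod n" if "i div n = j div n"
      using that \<open>i < j\<close> by (metis div_mult_mod_eq less_irrefl)
    ultimately show ?thesis using that \<open>n > 0\<close> by (auto simp: entry)
  qed
  then have "det ?T = prod_list (diag_mat ?T)"
    by (intro det_lower_triangular[where n = "N * n"] time_stepping_mat_carrier)
  also have "diag_mat ?T = replicate (N * n) 1"
  proof (rule nth_equalityI)
    fix i assume "i < length (diag_mat ?T)"
    then have i: "i < N * n" by (simp add: diag_mat_def)  (metis carrier_matD(1) time_stepping_mat_carrier)
    then have "n > 0" by (cases n) auto
    then show "diag_mat ?T ! i = replicate (N * n) 1 ! i"
      using i carrier_matD(1)[OF time_stepping_mat_carrier[of N n P]]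
      by (simp add: diag_mat_def entry)
  qed (simp add: diag_mat_def carrier_matD(1)[OF time_stepping_mat_carrier[of N n P]])
  finally show ?thesis by simp
qed

section \<open>Inverses, adjoints and the weighted norm\<close>

lemma inv_mat_left_right:
  fixes A :: "'a::field mat"
  assumes A: "A \<in> carrier_mat n n" and "det A \<noteq> 0"
  shows "inv_mat A \<in> carrier_mat n n" "A * inv_mat A = 1\<^sub>m n" "inv_mat A * A = 1\<^sub>m n"
proof -
  obtain B where B: "mat_inverse A = Some B"
    using mat_inverse(1)[OF A, of undefined] det_non_zero_imp_unit[OF assms, of undefined]
    by (cases "mat_inverse A") auto
  then show "inv_mat A \<in> carrier_mat n n" "A * inv_mat A = 1\<^sub>m n" "inv_mat A * A = 1\<^sub>m n"
    using mat_inverse(2)[OF A B] by (simp_all add: inv_mat_def)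
qed

lemma inv_mat_eqI:
  fixes A :: "'a::field mat"
  assumes A: "A \<in> carrier_mat n n" and B: "B \<in> carrier_mat n n" and AB: "A * B = 1\<^sub>m n"
  shows "inv_mat A = B"
proof -
  have "det A \<noteq> 0" using det_mult[OF A B] AB by auto
  note inv = inv_mat_left_right[OF A this]
  have "inv_mat A = inv_mat A * (A * B)" using AB inv(1) by simp
  also have "\<dots> = (inv_mat A * A) * B" using assoc_mult_mat[OF inv(1) A B] by simp
  finally show ?thesis using inv(3) B by simp
qed

lemma mat_adjoint_altdef:
  "mat_adjoint A = map_mat cnj (transpose_mat A)"
  by (rule eq_matI) (auto simp: mat_adjoint_def mat_of_rows_def)

lemma mat_adjoint_carrier [simp]:
  fixes A :: "complex mat"
  assumes "A \<in> carrier_mat nr nc"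
  shows "mat_adjoint A \<in> carrier_mat nc nr"
  using assms by (simp add: mat_adjoint_altdef)

lemma mat_adjoint_mult:
  fixes A B :: "complex mat"
  assumes "A \<in> carrier_mat nr n" "B \<in> carrier_mat n nc"
  shows "mat_adjoint (A * B) = mat_adjoint B * mat_adjoint A"
proof -
  interpret semiring_hom cnj by unfold_locales simp_all
  show ?thesis
    unfolding mat_adjoint_altdef transpose_mult[OF assms]
    by (rule mat_hom_mult) (use assms in auto)
qed

lemma mat_adjoint_one: "mat_adjoint (1\<^sub>m n :: complex mat) = 1\<^sub>m n"
  by (rule eq_matI) (auto simp: mat_adjoint_altdef)

lemma mat_adjoint_cscalar_prod:
  fixes A :: "complex mat"
  assumes A: "A \<in> carrier_mat nr nc" and u: "u \<in> carrier_vec nr" and x: "x \<in> carrier_vec nc"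
  shows "(mat_adjoint A *\<^sub>v u) \<bullet>c x = u \<bullet>c (A *\<^sub>v x)"
proof -
  have "(mat_adjoint A *\<^sub>v u) \<bullet>c x = (\<Sum>j<nc. \<Sum>i<nr. cnj (A $$ (i, j)) * u $ i * cnj (x $ j))"
  proof -
    have "(mat_adjoint A *\<^sub>v u) $ j = (\<Sum>i<nr. cnj (A $$ (i, j)) * u $ i)" if "j < nc" for j
      unfolding mult_mat_vec_index_sum[OF mat_adjoint_carrier[OF A] u that]
      using that A by (intro sum.cong refl) (simp add: mat_adjoint_altdef)
    then show ?thesis using A x
      by (simp add: scalar_prod_def atLeast0LessThan sum_distrib_right)
  qed
  also have "\<dots> = (\<Sum>i<nr. u $ i * cnj (\<Sum>j<nc. A $$ (i, j) * x $ j))"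
    by (subst sum.swap) (simp add: sum_distrib_left mult.assoc mult.left_commute)
  also have "\<dots> = u \<bullet>c (A *\<^sub>v x)"
    using A u by (simp add: scalar_prod_def[of u] atLeast0LessThan mult_mat_vec_index_sum[OF A x]
        del: index_mult_mat_vec)
  finally show ?thesis .
qed

lemma inv_mat_gram:
  fixes U W :: "complex mat"
  assumes U: "U \<in> carrier_mat n n" and W: "W \<in> carrier_mat n n" and UW: "U * W = 1\<^sub>m n"
  shows "inv_mat (U * mat_adjoint U) = mat_adjoint W * W"
proof -
  have WU: "W * U = 1\<^sub>m n" by (rule mat_mult_left_right_inverse[OF U W UW])
  note adj = mat_adjoint_carrier[OF U] mat_adjoint_carrier[OF W]
  have gram: "mat_adjoint W * W \<in> carrier_mat n n" using adj(2) W by (rule mult_carrier_mat)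
  have "(U * mat_adjoint U) * (mat_adjoint W * W) = U * (mat_adjoint U * (mat_adjoint W * W))"
    using U W adj gram by (intro assoc_mult_mat[of _ n n _ n _ n]) auto
  also have "mat_adjoint U * (mat_adjoint W * W) = (mat_adjoint U * mat_adjoint W) * W"
    using U W adj gram by (intro assoc_mult_mat[of _ n n _ n _ n, symmetric]) auto
  also have "mat_adjoint U * mat_adjoint W = 1\<^sub>m n"
    using mat_adjoint_mult[OF W U] by (simp add: WU mat_adjoint_one)
  finally have "(U * mat_adjoint U) * (mat_adjoint W * W) = 1\<^sub>m n"
    using U W UW by simp
  then show ?thesis
    using mult_carrier_mat[OF U adj(1)] gram by (intro inv_mat_eqI[of _ n])
qed

lemma weighted_norm_inv_gram:
  assumes U: "U \<in> carrier_mat n n" and W: "W \<in> carrier_mat n n" and UW: "U * W = 1\<^sub>m n"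
    and x: "x \<in> carrier_vec n"
  shows "weighted_norm (inv_mat (U * mat_adjoint U)) x = sqrt (\<Sum>j<n. (cmod ((W *\<^sub>v x) $ j))\<^sup>2)"
proof -
  note inv = inv_mat_gram[OF U W UW]
  have Wx: "W *\<^sub>v x \<in> carrier_vec n" using W x by auto
  have "(inv_mat (U * mat_adjoint U) *\<^sub>v x) \<bullet>c x = (mat_adjoint W *\<^sub>v (W *\<^sub>v x)) \<bullet>c x"
    unfolding inv using assoc_mult_mat_vec[OF mat_adjoint_carrier[OF W] W x] by simp
  also have "\<dots> = (W *\<^sub>v x) \<bullet>c (W *\<^sub>v x)"
    by (rule mat_adjoint_cscalar_prod[OF W Wx x])
  also have "\<dots> = (\<Sum>j<n. (W *\<^sub>v x) $ j * cnj ((W *\<^sub>v x) $ j))"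
    using carrier_vecD[OF Wx] by (simp add: scalar_prod_def atLeast0LessThan del: index_mult_mat_vec)
  also have "\<dots> = of_real (\<Sum>j<n. (cmod ((W *\<^sub>v x) $ j))\<^sup>2)"
    by (simp only: of_real_sum complex_norm_square)
  finally show ?thesis by (simp only: weighted_norm_def Re_complex_of_real)
qed

lemma det_diag_block_mat_replicate:
  fixes V :: "'a::field mat"
  assumes V: "V \<in> carrier_mat n n"
  shows "Determinant.det (diag_block_mat (replicate N V)) = Determinant.det V ^ N"
proof (induction N)
  case 0
  show ?case by (simp add: Determinant.det_def)
next
  case (Suc N)
  have D: "diag_block_mat (replicate N V) \<in> carrier_mat (N * n) (N * n)"
    by (rule diag_block_mat_replicate_carrier[OF V])
  have "diag_block_mat (replicate (Suc N) V)
      = four_block_mat V (0\<^sub>m n (N * n)) (0\<^sub>m (N * n) n) (diag_block_mat (replicate N V))"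
    using V D by (simp add: Let_def)
  then show ?case
    using det_four_block_mat_upper_right_zero[OF V refl _ D] Suc.IH by simp
qed

section \<open>The error propagator in the eigenvector basis\<close>

lemma det_basis_nonzero:
  fixes v :: "nat \<Rightarrow> 'a::field vec"
  assumes inj: "inj_on v {..<n}"
    and basis: "vectorspace.basis class_ring (module_vec TYPE('a) n) (v ` {..<n})"
  shows "Determinant.det (mat_of_cols n (map v [0..<n])) \<noteq> 0"
proof -
  interpret vec_space "TYPE('a)" n .
  let ?V = "mat_of_cols n (map v [0..<n])"
  have carrier: "set (map v [0..<n]) \<subseteq> carrier_vec n"
    using basis by (auto simp: basis_def)
  have "lin_indpt (v ` {..<n})" using basis by (simp add: basis_def)
  moreover have cols: "cols ?V = map v [0..<n]" using carrier by (rule cols_mat_of_cols)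
  moreover have V: "?V \<in> carrier_mat n n" by (intro carrier_matI) simp_all
  ultimately have "rank ?V = n"
    using inj by (intro lin_indpt_full_rank V) (simp_all add: distinct_map atLeast0LessThan)
  then show ?thesis using det_rank_iff[OF V] by simp
qed

lemma map_mat_time_stepping_mat:
  fixes P :: "real mat"
  assumes "P \<in> carrier_mat n n"
  shows "map_mat complex_of_real (time_stepping_mat N n P)
    = time_stepping_mat N n (map_mat complex_of_real P)"
proof (rule eq_matI)
  fix i j assume "i < dim_row (time_stepping_mat N n (map_mat complex_of_real P))"
    "j < dim_col (time_stepping_mat N n (map_mat complex_of_real P))"
  then have ij: "i < N * n" "j < N * n"
    by (simp_all add: time_stepping_mat_def uniform_block_mat_def)
  then have "n > 0" by (cases n) auto
  then show "map_mat complex_of_real (time_stepping_mat N n P) $$ (i, j)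
      = time_stepping_mat N n (map_mat complex_of_real P) $$ (i, j)"
    using ij assms by (simp add: time_stepping_mat_def uniform_block_mat_def)
qed (simp_all add: time_stepping_mat_def uniform_block_mat_def)

lemma map_mat_inv_mat:
  fixes A :: "real mat"
  assumes A: "A \<in> carrier_mat n n" and "Determinant.det A \<noteq> 0"
  shows "map_mat complex_of_real (inv_mat A) = inv_mat (map_mat complex_of_real A)"
proof -
  note inv = inv_mat_left_right[OF assms]
  have "map_mat complex_of_real A * map_mat complex_of_real (inv_mat A) = 1\<^sub>m n"
    unfolding of_real_hom.mat_hom_mult[OF A inv(1), symmetric]
    by (simp only: inv(2) of_real_hom.mat_hom_one)
  then show ?thesis using A inv(1) by (intro inv_mat_eqI[symmetric, of _ n]) auto
qed

text \<open>The propagator is real, but its diagonalisation may require complex coordinates.\<close>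

lemma map_mat_mgrit_FCF_error:
  fixes P Pc :: "real mat"
  assumes P: "P \<in> carrier_mat n n" and Pc: "Pc \<in> carrier_mat n n"
  shows "map_mat complex_of_real (mgrit_FCF_error N n m w P Pc)
    = mgrit_FCF_error N n m (of_real w) (map_mat complex_of_real P) (map_mat complex_of_real Pc)"
proof -
  let ?h = "map_mat complex_of_real" and ?I = "1\<^sub>m (N * n)"
  let ?A = "time_stepping_mat N n (P ^\<^sub>m m)" and ?B = "time_stepping_mat N n Pc"
  have A: "?A \<in> carrier_mat (N * n) (N * n)" and B: "?B \<in> carrier_mat (N * n) (N * n)" by simp_all
  have "Determinant.det ?B \<noteq> 0" by (simp add: det_time_stepping_mat)
  note inv = inv_mat_left_right(1)[OF B this] map_mat_inv_mat[OF B this]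
  have diff: "?h (X - Y) = ?h X - ?h Y" if "X \<in> carrier_mat (N * n) (N * n)"
    "Y \<in> carrier_mat (N * n) (N * n)" for X Y
    using that by (intro eq_matI) auto
  have smult: "?h (w \<cdot>\<^sub>m X) = of_real w \<cdot>\<^sub>m ?h X" for X
    by (intro eq_matI) auto
  have IA: "?I - inv_mat ?B * ?A \<in> carrier_mat (N * n) (N * n)"
    "?I - w \<cdot>\<^sub>m ?A \<in> carrier_mat (N * n) (N * n)" "inv_mat ?B * ?A \<in> carrier_mat (N * n) (N * n)"
    "w \<cdot>\<^sub>m ?A \<in> carrier_mat (N * n) (N * n)"
    using mult_carrier_mat[OF inv(1) A] A by (auto intro: minus_carrier_mat)
  have "?h (mgrit_FCF_error N n m w P Pc) = ?h (?I - inv_mat ?B * ?A) * ?h (?I - w \<cdot>\<^sub>m ?A)"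
    unfolding mgrit_FCF_error_def Let_def by (rule of_real_hom.mat_hom_mult[OF IA(1,2)])
  also have "?h (?I - inv_mat ?B * ?A) = ?I - ?h (inv_mat ?B) * ?h ?A"
    by (simp only: diff[OF one_carrier_mat IA(3)] of_real_hom.mat_hom_mult[OF inv(1) A]
        of_real_hom.mat_hom_one)
  also have "?h (?I - w \<cdot>\<^sub>m ?A) = ?I - of_real w \<cdot>\<^sub>m ?h ?A"
    using diff[OF one_carrier_mat IA(4)] by (simp add: of_real_hom.mat_hom_one smult)
  finally show ?thesis
    unfolding mgrit_FCF_error_def Let_def inv(2)
    by (simp add: map_mat_time_stepping_mat[OF Pc] map_mat_time_stepping_mat[OF pow_carrier_mat[OF P]]
        of_real_hom.mat_hom_pow[OF P])
qed

text \<open>In eigenvector coordinates the error propagator acts on each mode \<open>j mod n\<close> as the scalar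
  iteration. The coordinate sequence is continued by zero beyond the last time point; by
  causality this does not affect the entries of the result.\<close>

lemma mgrit_FCF_error_eigenbasis:
  fixes P Pc V :: "complex mat" and lam mu :: "nat \<Rightarrow> complex"
  assumes P: "P \<in> carrier_mat n n" and Pc: "Pc \<in> carrier_mat n n" and V: "V \<in> carrier_mat n n"
    and eigP: "\<And>k. k < n \<Longrightarrow> eigenvector P (col V k) (lam k)"
    and eigPc: "\<And>k. k < n \<Longrightarrow> eigenvector Pc (col V k) (mu k)"
    and y: "y \<in> carrier_vec (N * n)"
  defines "U \<equiv> diag_block_mat (replicate N V)"
  shows "mgrit_FCF_error N n m w P Pc *\<^sub>v (U *\<^sub>v y) = U *\<^sub>v vec (N * n)
    (\<lambda>j. fcf_scalar w (lam (j mod n) ^ m) (mu (j mod n))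
           (\<lambda>p. if p < N then y $ (p * n + j mod n) else 0) (j div n))"
    (is "?E *\<^sub>v (U *\<^sub>v y) = U *\<^sub>v ?r")
proof -
  define A where "A = time_stepping_mat N n (P ^\<^sub>m m)"
  define B where "B = time_stepping_mat N n Pc"
  have Pm: "P ^\<^sub>m m \<in> carrier_mat n n" by (rule pow_carrier_mat[OF P])
  have A: "A \<in> carrier_mat (N * n) (N * n)" and B: "B \<in> carrier_mat (N * n) (N * n)"
    by (simp_all add: A_def B_def)
  have U: "U \<in> carrier_mat (N * n) (N * n)"
    unfolding U_def by (rule diag_block_mat_replicate_carrier[OF V])
  have "Determinant.det B \<noteq> 0" by (simp add: B_def det_time_stepping_mat)
  note invB = inv_mat_left_right[OF B this]
  have eig_sum: "(\<Sum>j<n. Q $$ (i, j) * V $$ (j, k)) = c * V $$ (i, k)"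
    if Q: "Q \<in> carrier_mat n n" and Qv: "Q *\<^sub>v col V k = c \<cdot>\<^sub>v col V k" and ik: "i < n" "k < n" for Q c i k
  proof -
    have "col V k \<in> carrier_vec n" using V ik by auto
    then have "(\<Sum>j<n. Q $$ (i, j) * col V k $ j) = (c \<cdot>\<^sub>v col V k) $ i"
      unfolding Qv[symmetric] by (rule mult_mat_vec_index_sum[OF Q _ ik(1), symmetric])
    then show ?thesis using V ik by simp
  qed
  \<comment> \<open>The action of a time-stepping matrix with eigenvalues \<open>c\<close> in eigenvector coordinates.\<close>
  define shift where
    "shift c x = vec (N * n) (\<lambda>j. x $ j - (if j < n then 0 else c (j mod n) * x $ (j - n)))"
    for c :: "nat \<Rightarrow> complex" and x :: "complex vec"
  have shift_carrier: "shift c x \<in> carrier_vec (N * n)" for c x by (simp add: shift_def)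
  have A_U: "A *\<^sub>v (U *\<^sub>v x) = U *\<^sub>v shift (\<lambda>k. lam k ^ m) x" if "x \<in> carrier_vec (N * n)" for x
    unfolding A_def U_def shift_def
    by (rule time_stepping_mat_eigenbasis[OF Pm V that eig_sum[OF Pm eigenvector_pow[OF P eigP]]])
  have B_U: "B *\<^sub>v (U *\<^sub>v x) = U *\<^sub>v shift mu x" if "x \<in> carrier_vec (N * n)" for x
    unfolding B_def U_def shift_def
    by (rule time_stepping_mat_eigenbasis[OF Pc V that eig_sum[OF Pc]])
      (use eigPc in \<open>simp add: eigenvector_def\<close>)
  have Uy: "U *\<^sub>v y \<in> carrier_vec (N * n)" using U y by auto
  define z where "z = y - w \<cdot>\<^sub>v shift (\<lambda>k. lam k ^ m) y"
  have z: "z \<in> carrier_vec (N * n)" using y shift_carrier by (simp add: z_def)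
  have r: "?r \<in> carrier_vec (N * n)" by simp
  have relax: "(1\<^sub>m (N * n) - w \<cdot>\<^sub>m A) *\<^sub>v (U *\<^sub>v y) = U *\<^sub>v z"
  proof -
    have "(w \<cdot>\<^sub>m A) *\<^sub>v (U *\<^sub>v y) = w \<cdot>\<^sub>v (A *\<^sub>v (U *\<^sub>v y))"
      using A Uy carrier_vecD[OF Uy]
      by (intro eq_vecI) (simp_all add: smult_scalar_prod_distrib[of _ "N * n"])
    then have "(1\<^sub>m (N * n) - w \<cdot>\<^sub>m A) *\<^sub>v (U *\<^sub>v y) = U *\<^sub>v y - w \<cdot>\<^sub>v (A *\<^sub>v (U *\<^sub>v y))"
      using A Uy by (simp add: minus_mult_distrib_mat_vec[of _ "N * n" "N * n"])
    also have "\<dots> = U *\<^sub>v z"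
      using mult_minus_distrib_mat_vec[OF U y, of "w \<cdot>\<^sub>v shift (\<lambda>k. lam k ^ m) y"]
        mult_mat_vec[OF U shift_carrier, of w] shift_carrier
      by (simp add: z_def A_U[OF y])
    finally show ?thesis .
  qed
  have r_index: "?r $ (p * n + i) = fcf_scalar w (lam i ^ m) (mu i)
      (\<lambda>p. if p < N then y $ (p * n + i) else 0) p" if "p < N" "i < n" for p i
    using that by (simp add: block_index_less cong: if_cong)
  \<comment> \<open>The recursion for the scalar iteration says that \<open>B (U r) = (B - A) (U z)\<close>, where \<open>U z\<close> is the
    relaxed error; applying the inverse of \<open>B\<close> yields the error propagator.\<close>
  have rec: "shift mu ?r = shift mu z - shift (\<lambda>k. lam k ^ m) z"
  proof (rule eq_vecI)
    fix j assume "j < dim_vec (shift mu z - shift (\<lambda>k. lam k ^ m) z)"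
    then have jlt: "j < N * n" by (simp add: shift_def)
    then obtain p i where j: "p < N" "i < n" "j = p * n + i" by (rule block_indexE)
    show "shift mu ?r $ j = (shift mu z - shift (\<lambda>k. lam k ^ m) z) $ j"
    proof (cases p)
      case 0
      then show ?thesis using j jlt by (simp add: shift_def)
    next
      case (Suc q)
      have j': "j - n = q * n + i" "\<not> j < n" using j Suc by simp_all
      have modn: "j mod n = i" "j div n = Suc q" "(q * n + i) mod n = i" "(q * n + i) div n = q"
        using j by (simp_all add: Suc del: mult_Suc)
      have lt: "q * n + i < N * n" "q < N" using block_index_less[of q N i n] j Suc by simp_all
      have "q * n + i < n \<longleftrightarrow> q = 0" using j by (cases q) auto
      moreover have "q * n + i - n = (q - 1) * n + i" if "q \<noteq> 0" using that by (cases q) auto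
      ultimately have zq: "z $ (q * n + i) = (1 - w) * y $ (q * n + i)
          + w * lam i ^ m * (if q = 0 then 0 else y $ ((q - 1) * n + i))"
        using y lt modn by (simp add: z_def shift_def algebra_simps)
      have r_at_j: "?r $ j = fcf_scalar w (lam i ^ m) (mu i)
          (\<lambda>p. if p < N then y $ (p * n + i) else 0) (Suc q)"
        using r_index[OF j(1,2)] unfolding j(3) Suc .
      have "shift mu ?r $ j = (lam i ^ m - mu i) * z $ (q * n + i)"
      proof -
        have "shift mu ?r $ j = ?r $ j - mu i * ?r $ (q * n + i)"
          using jlt by (simp only: shift_def index_vec j' modn if_False)
        also have "\<dots> = (lam i ^ m - mu i) * z $ (q * n + i)"
          unfolding r_at_j r_index[OF lt(2) j(2)] zq using lt(2) less_imp_diff_less[OF lt(2), of 1] by simp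
        finally show ?thesis .
      qed
      also have "\<dots> = (shift mu z - shift (\<lambda>k. lam k ^ m) z) $ j"
        using jlt by (simp add: shift_def j' modn algebra_simps)
      finally show ?thesis .
    qed
  qed (simp add: shift_def)
  have Uz: "U *\<^sub>v z \<in> carrier_vec (N * n)" and Ur: "U *\<^sub>v ?r \<in> carrier_vec (N * n)"
    using U z by auto
  have BUr: "B *\<^sub>v (U *\<^sub>v ?r) = B *\<^sub>v (U *\<^sub>v z) - A *\<^sub>v (U *\<^sub>v z)"
    unfolding B_U[OF r] B_U[OF z] A_U[OF z] rec
    by (rule mult_minus_distrib_mat_vec[OF U shift_carrier shift_carrier])
  have inv_B: "inv_mat B *\<^sub>v (B *\<^sub>v x) = x" if "x \<in> carrier_vec (N * n)" for x
    using assoc_mult_mat_vec[OF invB(1) B that] that by (simp add: invB(3))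
  have "U *\<^sub>v ?r = inv_mat B *\<^sub>v (B *\<^sub>v (U *\<^sub>v ?r))"
    by (rule inv_B[OF Ur, symmetric])
  also have "\<dots> = inv_mat B *\<^sub>v (B *\<^sub>v (U *\<^sub>v z)) - inv_mat B *\<^sub>v (A *\<^sub>v (U *\<^sub>v z))"
    unfolding BUr
    by (rule mult_minus_distrib_mat_vec[OF invB(1) mult_mat_vec_carrier[OF B Uz] mult_mat_vec_carrier[OF A Uz]])
  also have "\<dots> = U *\<^sub>v z - inv_mat B *\<^sub>v (A *\<^sub>v (U *\<^sub>v z))"
    unfolding inv_B[OF Uz] ..
  also have "\<dots> = (1\<^sub>m (N * n) - inv_mat B * A) *\<^sub>v (U *\<^sub>v z)"
    using minus_mult_distrib_mat_vec[OF one_carrier_mat mult_carrier_mat[OF invB(1) A] Uz]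
      assoc_mult_mat_vec[OF invB(1) A Uz] Uz by simp
  also have "\<dots> = (1\<^sub>m (N * n) - inv_mat B * A) *\<^sub>v ((1\<^sub>m (N * n) - w \<cdot>\<^sub>m A) *\<^sub>v (U *\<^sub>v y))"
    unfolding relax ..
  also have "\<dots> = ?E *\<^sub>v (U *\<^sub>v y)"
    unfolding mgrit_FCF_error_def Let_def A_def[symmetric] B_def[symmetric]
    by (rule assoc_mult_mat_vec[symmetric, OF _ _ Uy])
      (use A mult_carrier_mat[OF invB(1) A] in \<open>auto intro: minus_carrier_mat\<close>)
  finally show ?thesis ..
qed

section \<open>The norm bound\<close>

theorem theorem1:
  fixes Nx NT m :: nat
    and \<omega>C :: real
    and \<Phi> \<Phi>c :: "real mat"
    and v :: "nat \<Rightarrow> complex vec"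
    and lam mu :: "nat \<Rightarrow> complex"
    and U M :: "complex mat"
  assumes "Nx > 0" and "NT > 0" and "m > 0" and "\<omega>C > 0"
    and "\<Phi> \<in> carrier_mat Nx Nx" and "\<Phi>c \<in> carrier_mat Nx Nx"
    and "inj_on v {..<Nx}"
    and "vectorspace.basis class_ring (module_vec TYPE(complex) Nx) (v ` {..<Nx})"
    and "\<And>\<gamma>. \<gamma> < Nx \<Longrightarrow> eigenvector (map_mat complex_of_real \<Phi>) (v \<gamma>) (lam \<gamma>)"
    and "\<And>\<gamma>. \<gamma> < Nx \<Longrightarrow> eigenvector (map_mat complex_of_real \<Phi>c) (v \<gamma>) (mu \<gamma>)"
    and "\<And>\<gamma>. \<gamma> < Nx \<Longrightarrow> cmod (lam \<gamma>) < 1"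
    and "\<And>\<gamma>. \<gamma> < Nx \<Longrightarrow> cmod (mu \<gamma>) < 1"
    and "U = diag_block_mat (replicate NT (mat_of_cols Nx (map v [0..<Nx])))"
    and "M = inv_mat (U * mat_adjoint U)"
  shows "weighted_op_norm M (map_mat complex_of_real (mgrit_FCF_error NT Nx m \<omega>C \<Phi> \<Phi>c))
    \<le> (MAX \<gamma>\<in>{..<Nx}. GREATEST r. \<exists>x\<in>{0..2 * pi}.
          r = cmod (lam \<gamma> ^ m - mu \<gamma>) / cmod (1 - exp (\<i> * of_real x) * mu \<gamma>)
              * cmod (1 - of_real \<omega>C + exp (\<i> * of_real x) * of_real \<omega>C * lam \<gamma> ^ m))"
proof -
  define V where "V = mat_of_cols Nx (map v [0..<Nx])"
  define d where "d = NT * Nx"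
  define W where "W = inv_mat U"
  define E where "E = map_mat complex_of_real (mgrit_FCF_error NT Nx m \<omega>C \<Phi> \<Phi>c)"
  let ?G = "\<lambda>\<gamma>. GREATEST r. \<exists>x\<in>{0..2 * pi}.
          r = cmod (lam \<gamma> ^ m - mu \<gamma>) / cmod (1 - exp (\<i> * of_real x) * mu \<gamma>)
              * cmod (1 - of_real \<omega>C + exp (\<i> * of_real x) * of_real \<omega>C * lam \<gamma> ^ m)"
  define C where "C = (MAX \<gamma>\<in>{..<Nx}. ?G \<gamma>)"
  have d: "d > 0" using assms(1,2) by (simp add: d_def)
  have V: "V \<in> carrier_mat Nx Nx" unfolding V_def by (intro carrier_matI) simp_all
  have v: "v k \<in> carrier_vec Nx" if "k < Nx" for k
    using assms(9)[OF that] assms(5) by (simp add: eigenvector_def)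
  have colV: "col V k = v k" if "k < Nx" for k
    using that v by (simp add: V_def)
  have U_eq: "U = diag_block_mat (replicate NT V)" by (simp add: assms(13) V_def)
  have U: "U \<in> carrier_mat d d"
    unfolding U_eq d_def by (rule diag_block_mat_replicate_carrier[OF V])
  have "Determinant.det U \<noteq> 0"
    unfolding U_eq det_diag_block_mat_replicate[OF V]
    using det_basis_nonzero[OF assms(7,8)] by (simp add: V_def)
  note W = inv_mat_left_right[OF U this, folded W_def]
  have norm: "weighted_norm M x = sqrt (\<Sum>j<d. (cmod ((W *\<^sub>v x) $ j))\<^sup>2)" if "x \<in> carrier_vec d" for x
    unfolding assms(14) by (rule weighted_norm_inv_gram[OF U W(1,2) that])
  have symbol_le: "cmod (lam \<gamma> ^ m - mu \<gamma>) / cmod (1 - z * mu \<gamma>)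
      * cmod (1 - of_real \<omega>C + z * of_real \<omega>C * lam \<gamma> ^ m) \<le> C" if "\<gamma> < Nx" "cmod z = 1" for \<gamma> z
  proof -
    have "?G \<gamma> \<le> C" unfolding C_def using that by (intro Max_ge) auto
    then show ?thesis
      using symbol_le_Greatest[OF assms(12)[OF that(1)] that(2)] order_trans by blast
  qed
  have "C \<ge> 0"
    by (rule order_trans[OF _ symbol_le[of 0 1]]) (use assms(1) in auto)
  have symbol_bound: "cmod (lam \<gamma> ^ m - mu \<gamma>) * cmod (1 - of_real \<omega>C + z * (of_real \<omega>C * lam \<gamma> ^ m))
      \<le> C * cmod (1 - z * mu \<gamma>)" if "\<gamma> < Nx" "cmod z = 1" for \<gamma> z
  proof -
    have "z * mu \<gamma> \<noteq> 1"
      using assms(12)[OF that(1)] that(2) by (metis mult_1 norm_mult norm_one order_less_irrefl)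
    then have "cmod (1 - z * mu \<gamma>) > 0" by simp
    then show ?thesis using symbol_le[OF that] by (simp add: field_simps)
  qed
  have E_bound: "weighted_norm M (E *\<^sub>v x) \<le> C * weighted_norm M x" if x: "x \<in> carrier_vec d" for x
  proof -
    define y where "y = W *\<^sub>v x"
    define r where "r = vec d (\<lambda>j. fcf_scalar (of_real \<omega>C) (lam (j mod Nx) ^ m) (mu (j mod Nx))
           (\<lambda>p. if p < NT then y $ (p * Nx + j mod Nx) else 0) (j div Nx))"
    have y: "y \<in> carrier_vec d" unfolding y_def using W(1) x by (rule mult_mat_vec_carrier)
    have r: "r \<in> carrier_vec d" by (simp add: r_def)
    have Uy: "U *\<^sub>v y = x"
      unfolding y_def using assoc_mult_mat_vec[OF U W(1) x] W(2) x by simp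
    have "E *\<^sub>v (U *\<^sub>v y) = U *\<^sub>v r"
      unfolding E_def map_mat_mgrit_FCF_error[OF assms(5,6)] U_eq r_def d_def
      by (rule mgrit_FCF_error_eigenbasis)
        (use assms(5,6,9,10) V y in \<open>auto simp: colV d_def\<close>)
    then have Ex: "E *\<^sub>v x = U *\<^sub>v r" by (simp add: Uy)
    have "W *\<^sub>v (E *\<^sub>v x) = r"
      unfolding Ex using assoc_mult_mat_vec[OF W(1) U r] W(3) r by simp
    moreover have "E *\<^sub>v x \<in> carrier_vec d" unfolding Ex using U r by (rule mult_mat_vec_carrier)
    ultimately have norm_Ex: "weighted_norm M (E *\<^sub>v x) = sqrt (\<Sum>j<d. (cmod (r $ j))\<^sup>2)"
      using norm by simp
    have norm_x: "weighted_norm M x = sqrt (\<Sum>j<d. (cmod (y $ j))\<^sup>2)"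
      using norm[OF x] by (simp add: y_def)
    have "(\<Sum>j<d. (cmod (r $ j))\<^sup>2) = (\<Sum>i<Nx. \<Sum>p<NT. (cmod (r $ (p * Nx + i)))\<^sup>2)"
      unfolding d_def sum_blocks by (rule sum.swap)
    also have "\<dots> \<le> (\<Sum>i<Nx. C\<^sup>2 * (\<Sum>p<NT. (cmod (y $ (p * Nx + i)))\<^sup>2))"
    proof (intro sum_mono)
      fix i assume "i \<in> {..<Nx}"
      then have i: "i < Nx" by simp
      let ?y = "\<lambda>p. if p < NT then y $ (p * Nx + i) else 0"
      have "(\<Sum>p<NT. (cmod (r $ (p * Nx + i)))\<^sup>2)
          = (\<Sum>p<NT. (cmod (fcf_scalar (of_real \<omega>C) (lam i ^ m) (mu i) ?y p))\<^sup>2)"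
        using i by (intro sum.cong refl) (simp add: r_def d_def block_index_less cong: if_cong)
      also have "\<dots> \<le> C\<^sup>2 * (\<Sum>p<NT. (cmod (?y p))\<^sup>2)"
        by (rule fcf_scalar_bound[OF assms(12)[OF i] symbol_bound[OF i]]) simp_all
      finally show "(\<Sum>p<NT. (cmod (r $ (p * Nx + i)))\<^sup>2)
          \<le> C\<^sup>2 * (\<Sum>p<NT. (cmod (y $ (p * Nx + i)))\<^sup>2)" by simp
    qed
    also have "\<dots> = C\<^sup>2 * (\<Sum>j<d. (cmod (y $ j))\<^sup>2)"
      unfolding d_def sum_blocks sum_distrib_left by (rule sum.swap)
    finally have "sqrt (\<Sum>j<d. (cmod (r $ j))\<^sup>2) \<le> sqrt (C\<^sup>2 * (\<Sum>j<d. (cmod (y $ j))\<^sup>2))"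
      by (rule real_sqrt_le_mono)
    then show ?thesis
      unfolding norm_Ex norm_x using \<open>C \<ge> 0\<close> by (simp add: real_sqrt_mult)
  qed
  have "M = mat_adjoint W * W"
    unfolding assms(14) by (rule inv_mat_gram[OF U W(1,2)])
  then have dim: "dim_row M = d" using mat_adjoint_carrier[OF W(1)] by simp
  have "weighted_op_norm M E \<le> C"
    unfolding weighted_op_norm_def dim
  proof (rule cSUP_least)
    have "unit_vec d 0 \<in> carrier_vec d - {0\<^sub>v d}" using d by simp
    then show "carrier_vec d - {0\<^sub>v d} \<noteq> ({} :: complex vec set)" by blast
    fix x :: "complex vec" assume "x \<in> carrier_vec d - {0\<^sub>v d}"
    then have x: "x \<in> carrier_vec d" by simp
    have "weighted_norm M x \<ge> 0" using norm[OF x] by (simp add: sum_nonneg)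
    \<comment> \<open>A vanishing denominator is harmless, since division by zero yields zero.\<close>
    then show "weighted_norm M (E *\<^sub>v x) / weighted_norm M x \<le> C"
      using E_bound[OF x] \<open>C \<ge> 0\<close> by (cases "weighted_norm M x = 0") (auto simp: divide_le_eq)
  qed
  then show ?thesis unfolding E_def C_def .
qed

end
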